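(* Let $n$ be a nonnegative integer. There is a delicate overlap-free binary word of length $n$ if and only if $n \geq 7$.
   Context: Words are finite strings over the binary alphabet $\{0,1\}$. A factor of a word is a contiguous subword. An overlap is a word of the form $xYxYx$ where $x$ is a letter and $Y$ is a (possibly empty) word; a word is overlap-free if none of its factors is an overlap. A delicate overlap-free word is a nonempty overlap-free word such that changing any single one of its letters to the other letter of the alphabet yields a word containing an overlap as a factor. *)

theory Defs
  imports Main "HOL-Library.Sublist"
begin

(* The letters 0 and 1 are False and True, so changing a letter is negation.
   A factor is a contiguous subword, which is what sublist expresses
   (subseq is the scattered version). *)
type_synonym binary_word = "bool list"

definition overlap :: "'a list \<Rightarrow> bool" where
  "overlap u \<longleftrightarrow> (\<exists>x Y. u = [x] @ Y @ [x] @ Y @ [x])"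

definition overlap_free :: "'a list \<Rightarrow> bool" where
  "overlap_free w \<longleftrightarrow> \<not> (\<exists>u. sublist u w \<and> overlap u)"

definition delicate_overlap_free :: "binary_word \<Rightarrow> bool" where
  "delicate_overlap_free w \<longleftrightarrow>
     w \<noteq> [] \<and> overlap_free w \<and>
     (\<forall>i < length w. \<exists>u. sublist u (w[i := \<not> w ! i]) \<and> overlap u)"

end

theory Submission
  imports Defs
begin

text \<open>
  Witnesses are factors \<open>t[a..<a + n]\<close> of the Thue--Morse word. In every overlap-free word, changing a
  letter at distance at least 4 from both ends already creates an overlap inside the window of
  radius 4 around it, so only the ends matter. A right end congruent to 0 or 7 modulo 8 lies at the
  end of one of the blocks 0110100, 1101001 (or their complements), which are themselves delicate,
  and the left ends 0, 1, 3, 6, 13 are all safe; the differences of these ends meet every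
  residue class modulo 8.
\<close>

section \<open>Overlaps at positions of a sequence\<close>

text \<open>Sequences with a half-open range of positions \<open>a\<close>, ...,
  \<open>e - 1\<close> replace lists, so that windows and single changed letters need no list
  surgery. The bound is \<open>i + 2 * p < e\<close> because an overlap of period \<open>p\<close>
  has \<open>2 * p + 1\<close> letters.\<close>

definition overlap_in :: "(nat \<Rightarrow> 'a) \<Rightarrow> nat \<Rightarrow> nat \<Rightarrow> bool" where
  "overlap_in f a e \<longleftrightarrow> (\<exists>i p. a \<le> i \<and> 0 < p \<and> i + 2 * p < e \<and> (\<forall>j\<le>p. f (i + j) = f (i + j + p)))"

lemma overlap_inI:
  assumes "a \<le> i" "0 < p" "i + 2 * p < e" "\<And>j. j \<le> p \<Longrightarrow> f (i + j) = f (i + j + p)"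
  shows "overlap_in f a e"
  using assms unfolding overlap_in_def by blast

lemma overlap_in_mono:
  assumes "overlap_in f c d" "a \<le> c" "d \<le> e"
  shows "overlap_in f a e"
proof -
  obtain i p where "c \<le> i" "0 < p" "i + 2 * p < d" "\<forall>j\<le>p. f (i + j) = f (i + j + p)"
    using assms(1) unfolding overlap_in_def by blast
  then show ?thesis
    using assms(2,3) by (intro overlap_inI[of a i p]) auto
qed

text \<open>In xYxYx the period is |xY|, hence \<open>p = Suc (length Y)\<close>. The comparison at
  \<open>j = p\<close> is what separates an overlap from a mere square.\<close>

lemma overlap_iff_nth:
  "overlap u \<longleftrightarrow> (\<exists>p>0. length u = 2 * p + 1 \<and> (\<forall>j\<le>p. u ! j = u ! (j + p)))"
proof
  assume "overlap u"
  then obtain x Y where u: "u = (x # Y) @ (x # Y) @ [x]"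
    unfolding overlap_def by auto
  have "u ! j = u ! (j + Suc (length Y))" if "j \<le> Suc (length Y)" for j
    using that unfolding u by (auto simp: nth_append nth_Cons' le_Suc_eq)
  moreover have "length u = 2 * Suc (length Y) + 1"
    by (simp add: u)
  ultimately show "\<exists>p>0. length u = 2 * p + 1 \<and> (\<forall>j\<le>p. u ! j = u ! (j + p))"
    by blast
next
  assume "\<exists>p>0. length u = 2 * p + 1 \<and> (\<forall>j\<le>p. u ! j = u ! (j + p))"
  then obtain p where p: "p > 0" "length u = 2 * p + 1" and per: "\<And>j. j \<le> p \<Longrightarrow> u ! j = u ! (j + p)"
    by blast
  let ?v = "take p u"
  obtain x Y where v: "?v = x # Y"
    using p by (cases ?v) auto
  have x: "x = u ! 0"
    using v p(1) by (metis nth_Cons_0 nth_take)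
  have "take p (drop p u) = ?v"
    using p per by (intro nth_equalityI) (auto simp: add.commute)
  moreover have "drop (2 * p) u = [x]"
  proof -
    \<comment> \<open>The first letter is carried along two periods, from 0 to \<open>p\<close> and
      from \<open>p\<close> to \<open>2 * p\<close>.\<close>
    have "u ! (2 * p) = x"
      using per[of 0] per[of p] by (simp add: x mult_2)
    then show ?thesis
      using p Cons_nth_drop_Suc[of "2 * p" u] by simp
  qed
  moreover have "u = ?v @ take p (drop p u) @ drop (2 * p) u"
    by (metis append_take_drop_id drop_drop mult_2)
  ultimately have "u = ?v @ ?v @ [x]"
    by simp
  then show "overlap u"
    unfolding overlap_def v by force
qed

lemma contains_overlap_iff:
  "(\<exists>u. sublist u w \<and> overlap u) \<longleftrightarrow> overlap_in ((!) w) 0 (length w)"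
proof
  assume "\<exists>u. sublist u w \<and> overlap u"
  then obtain xs u ys where w: "w = xs @ u @ ys" and "overlap u"
    unfolding sublist_def by blast
  then obtain p where p: "p > 0" "length u = 2 * p + 1" "\<And>j. j \<le> p \<Longrightarrow> u ! j = u ! (j + p)"
    unfolding overlap_iff_nth by blast
  show "overlap_in ((!) w) 0 (length w)"
  proof (rule overlap_inI[of _ "length xs" p])
    fix j assume "j \<le> p"
    then show "w ! (length xs + j) = w ! (length xs + j + p)"
      using p(2) p(3)[of j] by (simp add: w nth_append add.assoc)
  qed (use p w in auto)
next
  assume "overlap_in ((!) w) 0 (length w)"
  then obtain i p where p: "0 < p" "i + 2 * p < length w"
    and per: "\<And>j. j \<le> p \<Longrightarrow> w ! (i + j) = w ! (i + j + p)"
    unfolding overlap_in_def by blast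
  let ?u = "take (2 * p + 1) (drop i w)"
  have "overlap ?u"
    unfolding overlap_iff_nth using p per by (intro exI[of _ p]) (auto simp: add.assoc)
  moreover have "sublist ?u w"
    by (meson sublist_drop sublist_order.order_trans sublist_take)
  ultimately show "\<exists>u. sublist u w \<and> overlap u"
    by blast
qed

lemma overlap_in_cong:
  assumes "\<And>i. a \<le> i \<Longrightarrow> i < e \<Longrightarrow> f i = g i"
  shows "overlap_in f a e \<longleftrightarrow> overlap_in g a e"
proof -
  have "overlap_in g a e" if fg: "\<And>i. a \<le> i \<Longrightarrow> i < e \<Longrightarrow> f i = g i" and f: "overlap_in f a e"
    for f g :: "nat \<Rightarrow> 'a"
  proof -
    obtain i p where *: "a \<le> i" "0 < p" "i + 2 * p < e" "\<forall>j\<le>p. f (i + j) = f (i + j + p)"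
      using f unfolding overlap_in_def by blast
    show ?thesis
    proof (rule overlap_inI)
      fix j assume "j \<le> p"
      then show "g (i + j) = g (i + j + p)"
        using * fg[of "i + j"] fg[of "i + j + p"] by auto
    qed (use * in auto)
  qed
  from this[of f g] this[of g f] show ?thesis
    using assms by auto
qed

lemma overlap_in_shift:
  "overlap_in (\<lambda>i. f (a + i)) 0 n \<longleftrightarrow> overlap_in f a (a + n)"
proof
  assume "overlap_in (\<lambda>i. f (a + i)) 0 n"
  then obtain i p where "0 < p" "i + 2 * p < n" "\<forall>j\<le>p. f (a + (i + j)) = f (a + (i + j + p))"
    unfolding overlap_in_def by blast
  then show "overlap_in f a (a + n)"
    by (intro overlap_inI[of _ "a + i" p]) (auto simp: add.assoc)
next
  assume "overlap_in f a (a + n)"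
  then obtain i p where *: "a \<le> i" "0 < p" "i + 2 * p < a + n" "\<forall>j\<le>p. f (i + j) = f (i + j + p)"
    unfolding overlap_in_def by blast
  from *(1) obtain k where "i = a + k"
    using le_Suc_ex by blast
  then show "overlap_in (\<lambda>i. f (a + i)) 0 n"
    using * by (intro overlap_inI[of _ k p]) (auto simp: add.assoc)
qed

definition flip :: "(nat \<Rightarrow> bool) \<Rightarrow> nat \<Rightarrow> nat \<Rightarrow> bool" where
  "flip f k = f(k := \<not> f k)"

lemma delicate_iff_nth:
  "delicate_overlap_free w \<longleftrightarrow>
     w \<noteq> [] \<and> \<not> overlap_in ((!) w) 0 (length w) \<and>
     (\<forall>k<length w. overlap_in (flip ((!) w) k) 0 (length w))"
proof -
  have "overlap_in ((!) (w[k := \<not> w ! k])) 0 (length w) \<longleftrightarrow>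
      overlap_in (flip ((!) w) k) 0 (length w)" if "k < length w" for k
    using that by (intro overlap_in_cong) (auto simp: flip_def)
  then show ?thesis
    unfolding delicate_overlap_free_def overlap_free_def contains_overlap_iff by auto
qed

text \<open>Changed positions are counted in the ambient sequence \<open>f\<close>, so facts about
  \<open>flip f k\<close> in a small window extend to every larger factor by
  \<open>overlap_in_mono\<close>.\<close>

lemma delicate_factor_iff:
  "delicate_overlap_free (map f [a..<a + n]) \<longleftrightarrow>
     0 < n \<and> \<not> overlap_in f a (a + n) \<and> (\<forall>k. a \<le> k \<longrightarrow> k < a + n \<longrightarrow> overlap_in (flip f k) a (a + n))"
proof -
  let ?w = "map f [a..<a + n]"
  have 0: "overlap_in ((!) ?w) 0 n \<longleftrightarrow> overlap_in f a (a + n)"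
    unfolding overlap_in_shift[symmetric] by (intro overlap_in_cong) simp
  have 1: "overlap_in (flip ((!) ?w) k) 0 n \<longleftrightarrow> overlap_in (flip f (a + k)) a (a + n)"
    if "k < n" for k
    unfolding overlap_in_shift[symmetric]
    using that by (intro overlap_in_cong) (auto simp: flip_def)
  have len: "length ?w = n"
    by simp
  have "(\<forall>k<n. overlap_in (flip ((!) ?w) k) 0 n) \<longleftrightarrow>
      (\<forall>k<n. overlap_in (flip f (a + k)) a (a + n))"
    using 1 by blast
  also have "\<dots> \<longleftrightarrow> (\<forall>k. a \<le> k \<longrightarrow> k < a + n \<longrightarrow> overlap_in (flip f k) a (a + n))"
  proof (intro iffI allI impI)
    fix k assume *: "\<forall>k<n. overlap_in (flip f (a + k)) a (a + n)" "a \<le> k" "k < a + n"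
    then show "overlap_in (flip f k) a (a + n)"
      using *(1)[rule_format, of "k - a"] by simp
  qed simp
  finally show ?thesis
    unfolding delicate_iff_nth len 0 using len by (simp only: length_greater_0_conv[symmetric])
qed

subsection \<open>Small windows\<close>

lemma overlap_in_of_period:
  shows "f i = f (i + 1) \<Longrightarrow> f (i + 1) = f (i + 2) \<Longrightarrow> a \<le> i \<Longrightarrow> i + 2 < e \<Longrightarrow> overlap_in f a e"
    and "f i = f (i + 2) \<Longrightarrow> f (i + 1) = f (i + 3) \<Longrightarrow> f (i + 2) = f (i + 4) \<Longrightarrow>
      a \<le> i \<Longrightarrow> i + 4 < e \<Longrightarrow> overlap_in f a e"
    and "f i = f (i + 3) \<Longrightarrow> f (i + 1) = f (i + 4) \<Longrightarrow> f (i + 2) = f (i + 5) \<Longrightarrow> f (i + 3) = f (i + 6) \<Longrightarrow>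
      a \<le> i \<Longrightarrow> i + 6 < e \<Longrightarrow> overlap_in f a e"
    and "f i = f (i + 4) \<Longrightarrow> f (i + 1) = f (i + 5) \<Longrightarrow> f (i + 2) = f (i + 6) \<Longrightarrow> f (i + 3) = f (i + 7) \<Longrightarrow>
      f (i + 4) = f (i + 8) \<Longrightarrow> a \<le> i \<Longrightarrow> i + 8 < e \<Longrightarrow> overlap_in f a e"
  subgoal by (rule overlap_inI[of a i 1]) (auto simp: le_Suc_eq numeral_eq_Suc)
  subgoal by (rule overlap_inI[of a i 2]) (auto simp: le_Suc_eq numeral_eq_Suc)
  subgoal by (rule overlap_inI[of a i 3]) (auto simp: le_Suc_eq numeral_eq_Suc)
  subgoal by (rule overlap_inI[of a i 4]) (auto simp: le_Suc_eq numeral_eq_Suc)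
  done

text \<open>Every way in which seven letters can contain an overlap: period 1 at five places, period
  2 at three, period 3 at one.\<close>

definition overlap7 :: "bool \<Rightarrow> bool \<Rightarrow> bool \<Rightarrow> bool \<Rightarrow> bool \<Rightarrow> bool \<Rightarrow> bool \<Rightarrow> bool" where
  "overlap7 b0 b1 b2 b3 b4 b5 b6 \<longleftrightarrow>
     b0 = b1 \<and> b1 = b2 \<or> b1 = b2 \<and> b2 = b3 \<or> b2 = b3 \<and> b3 = b4 \<or> b3 = b4 \<and> b4 = b5 \<or> b4 = b5 \<and> b5 = b6 \<or>
     b0 = b2 \<and> b1 = b3 \<and> b2 = b4 \<or> b1 = b3 \<and> b2 = b4 \<and> b3 = b5 \<or> b2 = b4 \<and> b3 = b5 \<and> b4 = b6 \<or>
     b0 = b3 \<and> b1 = b4 \<and> b2 = b5 \<and> b3 = b6"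

lemma overlap_in_window7:
  assumes "overlap7 (f c) (f (c + 1)) (f (c + 2)) (f (c + 3)) (f (c + 4)) (f (c + 5)) (f (c + 6))"
  shows "overlap_in f c (c + 7)"
  using assms overlap_in_of_period(1)[of f c c "c + 7"]
    overlap_in_of_period(1)[of f "c + 1" c "c + 7"]
    overlap_in_of_period(1)[of f "c + 2" c "c + 7"]
    overlap_in_of_period(1)[of f "c + 3" c "c + 7"]
    overlap_in_of_period(1)[of f "c + 4" c "c + 7"]
    overlap_in_of_period(2)[of f c c "c + 7"]
    overlap_in_of_period(2)[of f "c + 1" c "c + 7"]
    overlap_in_of_period(2)[of f "c + 2" c "c + 7"]
    overlap_in_of_period(3)[of f c c "c + 7"]
  unfolding overlap7_def by (simp add: eval_nat_numeral) blast

text \<open>Within nine letters an overlap of period at most 3 fits into one of three windows of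
  length 7, and one of period 4 fills the whole range. \<open>overlap_in_flip_center\<close> uses
  this directly for the changed sequence and contrapositively for the original one.\<close>

lemma overlap_in_window9:
  assumes "overlap7 (f c) (f (c + 1)) (f (c + 2)) (f (c + 3)) (f (c + 4)) (f (c + 5)) (f (c + 6)) \<or>
    overlap7 (f (c + 1)) (f (c + 2)) (f (c + 3)) (f (c + 4)) (f (c + 5)) (f (c + 6)) (f (c + 7)) \<or>
    overlap7 (f (c + 2)) (f (c + 3)) (f (c + 4)) (f (c + 5)) (f (c + 6)) (f (c + 7)) (f (c + 8)) \<or>
    f c = f (c + 4) \<and> f (c + 1) = f (c + 5) \<and> f (c + 2) = f (c + 6) \<and> f (c + 3) = f (c + 7) \<and>
      f (c + 4) = f (c + 8)"
  shows "overlap_in f c (c + 9)"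
  using assms
proof (elim disjE)
  assume "overlap7 (f c) (f (c + 1)) (f (c + 2)) (f (c + 3)) (f (c + 4)) (f (c + 5)) (f (c + 6))"
  then show ?thesis
    by (rule overlap_in_mono[OF overlap_in_window7]) auto
next
  assume "overlap7 (f (c + 1)) (f (c + 2)) (f (c + 3)) (f (c + 4)) (f (c + 5)) (f (c + 6)) (f (c + 7))"
  then have "overlap_in f (c + 1) (c + 1 + 7)"
    by (intro overlap_in_window7) (simp add: eval_nat_numeral)
  then show ?thesis
    by (rule overlap_in_mono) auto
next
  assume "overlap7 (f (c + 2)) (f (c + 3)) (f (c + 4)) (f (c + 5)) (f (c + 6)) (f (c + 7)) (f (c + 8))"
  then have "overlap_in f (c + 2) (c + 2 + 7)"
    by (intro overlap_in_window7) (simp add: eval_nat_numeral)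
  then show ?thesis
    by (rule overlap_in_mono) auto
next
  assume "f c = f (c + 4) \<and> f (c + 1) = f (c + 5) \<and> f (c + 2) = f (c + 6) \<and> f (c + 3) = f (c + 7) \<and>
      f (c + 4) = f (c + 8)"
  then show ?thesis
    by (intro overlap_in_of_period(4)[of f c]) auto
qed

text \<open>A finite check; once seven letters are fixed, simplification settles \<open>b7\<close>
  and \<open>b8\<close>. Radius 3 would be too small: 0010011 and 0011011 differ only in the middle
  letter and are both overlap-free.\<close>

lemma overlap7_flip_center:
  fixes b0 b1 b2 b3 b4 b5 b6 b7 b8 :: bool
  assumes "\<not> overlap7 b0 b1 b2 b3 b4 b5 b6" "\<not> overlap7 b1 b2 b3 b4 b5 b6 b7"
    "\<not> overlap7 b2 b3 b4 b5 b6 b7 b8"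
    "\<not> (b0 = b4 \<and> b1 = b5 \<and> b2 = b6 \<and> b3 = b7 \<and> b4 = b8)"
  shows "overlap7 b0 b1 b2 b3 (\<not> b4) b5 b6 \<or> overlap7 b1 b2 b3 (\<not> b4) b5 b6 b7 \<or>
    overlap7 b2 b3 (\<not> b4) b5 b6 b7 b8 \<or>
    (b0 = (\<not> b4) \<and> b1 = b5 \<and> b2 = b6 \<and> b3 = b7 \<and> (\<not> b4) = b8)"
  by (insert assms, unfold overlap7_def)
    (cases b0; cases b1; cases b2; cases b3; cases b4; cases b5; cases b6; simp)

lemma overlap_in_flip_center:
  assumes "\<not> overlap_in f c (c + 9)"
  shows "overlap_in (flip f (c + 4)) c (c + 9)"
proof (rule overlap_in_window9, unfold flip_def, simp, rule overlap7_flip_center)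
qed (use assms overlap_in_window9[of f c] in auto)

subsection \<open>The Thue--Morse word\<close>

text \<open>The parity of the number of ones in the binary expansion of \<open>n\<close>: the last
  digit is split off, and inequality of truth values acts as addition modulo 2.\<close>

fun tm :: "nat \<Rightarrow> bool" where
  "tm n = (if n = 0 then False else tm (n div 2) \<noteq> odd n)"

declare tm.simps [simp del]

lemma tm_0 [simp]: "tm 0 = False"
  by (simp add: tm.simps)

lemma tm_double [simp]: "tm (2 * n) = tm n"
  by (cases "n = 0") (simp_all add: tm.simps[of "2 * n"])

lemma tm_Suc_double [simp]: "tm (Suc (2 * n)) = (\<not> tm n)"
  by (simp add: tm.simps[of "Suc (2 * n)"])

lemma tm_numeral [simp]:
  "tm (Suc 0)" "tm 1" "tm (numeral (num.Bit0 k)) = tm (numeral k)"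
  "tm (numeral (num.Bit1 k)) = (\<not> tm (numeral k))"
  using tm_Suc_double[of 0] tm_double[of "numeral k"] tm_Suc_double[of "numeral k"]
  by (simp_all add: numeral_Bit0 numeral_Bit1 mult_2)

lemma tm_Suc_even: "even n \<Longrightarrow> tm (Suc n) = (\<not> tm n)"
  by (auto elim: evenE)

lemma tm_div_2: "tm n = (tm (n div 2) \<noteq> odd n)"
  by (cases "n = 0") (simp_all add: tm.simps[of n])

text \<open>Descent on the period: an even period can be halved by keeping every second position,
  while an odd one conflicts with \<open>tm (2 * k)\<close> and \<open>tm (2 * k + 1)\<close> being
  different.\<close>

lemma tm_no_overlap:
  assumes "0 < p"
  shows "\<exists>j\<le>p. tm (i + j) \<noteq> tm (i + j + p)"
  using assms
proof (induction p arbitrary: i rule: less_induct)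
  case (less p)
  show ?case
  proof (cases "even p")
    case True
    then obtain q where q: "p = 2 * q" by blast
    with less obtain j where j: "j \<le> q" "tm (i div 2 + j) \<noteq> tm (i div 2 + j + q)"
      by (metis less_add_same_cancel1 mult_2 nat_0_less_mult_iff)
    \<comment> \<open>Both positions have the parity of \<open>i\<close>, so their last binary
      digits cancel and the mismatch for \<open>q\<close> lifts to \<open>p\<close>.\<close>
    have "(i + 2 * j) div 2 = i div 2 + j" "(i + 2 * j + p) div 2 = i div 2 + j + q"
      using q by linarith+
    then have "tm (i + 2 * j) \<noteq> tm (i + 2 * j + p)"
      using j(2) True tm_div_2[of "i + 2 * j"] tm_div_2[of "i + 2 * j + p"] by (simp add: ac_simps)
    then show ?thesis
      using j(1) q by (intro exI[of _ "2 * j"]) auto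
  next
    case False
    show ?thesis
    proof (rule ccontr)
      assume "\<not> ?thesis"
      then have per: "tm (i + j) = tm (i + j + p)" if "j \<le> p" for j
        using that by blast
      \<comment> \<open>Letters at positions \<open>2k\<close>, \<open>2k + 1\<close> differ; the odd period transports this to the pairs
        \<open>2k + 1\<close>, \<open>2k + 2\<close>, so the second period alternates, against its equal ends.\<close>
      have step: "tm (i + p + Suc j) = (\<not> tm (i + p + j))" if "j < p" for j
      proof (cases "even (i + p + j)")
        case True
        then show ?thesis
          using tm_Suc_even[of "i + p + j"] by simp
      next
        case odd: False
        then have "tm (Suc (i + j)) = (\<not> tm (i + j))"
          using False by (intro tm_Suc_even) auto
        then show ?thesis
          using per[of j] per[of "Suc j"] that by (simp add: ac_simps)
      qed
      have "tm (i + p + j) = (tm (i + p) \<noteq> odd j)" if "j \<le> p" for j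
        using that by (induction j) (use step in auto)
      from this[of p] show False
        using False per[of 0] per[of p] by simp
    qed
  qed
qed

lemma tm_overlap_free: "\<not> overlap_in tm a e"
  using tm_no_overlap unfolding overlap_in_def by blast

lemma tm_double_add: "tm (2 * h + j) = (tm (h + j div 2) \<noteq> odd j)"
  by (simp add: tm_div_2[of "2 * h + j"])

text \<open>The third iterate of the morphism 0 -> 01, 1 -> 10: the word consists of blocks 01101001
  and their complements.\<close>

lemma tm_block:
  "tm (8 * m) = tm m" "tm (8 * m + 1) = (\<not> tm m)" "tm (8 * m + 2) = (\<not> tm m)" "tm (8 * m + 3) = tm m"
  "tm (8 * m + 4) = (\<not> tm m)" "tm (8 * m + 5) = tm m" "tm (8 * m + 6) = tm m"
  "tm (8 * m + 7) = (\<not> tm m)"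
proof -
  \<comment> \<open>Three binary digits of \<open>j\<close> are split off; for \<open>j < 8\<close>
    nothing is carried into \<open>m\<close>.\<close>
  have "tm (8 * m + j) = (((tm (m + j div 2 div 2 div 2) \<noteq> odd (j div 2 div 2)) \<noteq> odd (j div 2)) \<noteq> odd j)" for j
    using tm_double_add[of "4 * m" j] tm_double_add[of "2 * m" "j div 2"]
      tm_double_add[of m "j div 2 div 2"]
    by auto
  from this[of 0] this[of 1] this[of 2] this[of 3] this[of 4] this[of 5] this[of 6] this[of 7]
  show "tm (8 * m) = tm m" "tm (8 * m + 1) = (\<not> tm m)" "tm (8 * m + 2) = (\<not> tm m)"
    "tm (8 * m + 3) = tm m" "tm (8 * m + 4) = (\<not> tm m)" "tm (8 * m + 5) = tm m"
    "tm (8 * m + 6) = tm m" "tm (8 * m + 7) = (\<not> tm m)"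
    by simp_all
qed

section \<open>Both ends of a Thue--Morse factor\<close>

text \<open>The first seven letters of a block. Writing all letters relative to \<open>g 0\<close>
  treats the block and its complement together; the same holds for the last seven letters in the
  next lemma.\<close>

lemma overlap_in_flip_0110100:
  assumes "g 1 = (\<not> g 0)" "g 2 = (\<not> g 0)" "g 3 = g 0" "g 4 = (\<not> g 0)" "g 5 = g 0" "g 6 = g 0" "j < 7"
  shows "overlap_in (flip g j) 0 7"
proof -
  have "j = 0 \<or> j = 1 \<or> j = 2 \<or> j = 3 \<or> j = 4 \<or> j = 5 \<or> j = 6"
    using \<open>j < 7\<close> by linarith
  then have "overlap7 (flip g j 0) (flip g j 1) (flip g j 2) (flip g j 3) (flip g j 4) (flip g j 5) (flip g j 6)"
    by (elim disjE; cases "g 0"; simp add: assms(1-6)[simplified] flip_def overlap7_def)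
  then show ?thesis
    using overlap_in_window7[of "flip g j" 0] by (simp only: add_0)
qed

lemma overlap_in_flip_1101001:
  assumes "g 1 = g 0" "g 2 = (\<not> g 0)" "g 3 = g 0" "g 4 = (\<not> g 0)" "g 5 = (\<not> g 0)" "g 6 = g 0" "j < 7"
  shows "overlap_in (flip g j) 0 7"
proof -
  have "j = 0 \<or> j = 1 \<or> j = 2 \<or> j = 3 \<or> j = 4 \<or> j = 5 \<or> j = 6"
    using \<open>j < 7\<close> by linarith
  then have "overlap7 (flip g j 0) (flip g j 1) (flip g j 2) (flip g j 3) (flip g j 4) (flip g j 5) (flip g j 6)"
    by (elim disjE; cases "g 0"; simp add: assms(1-6)[simplified] flip_def overlap7_def)
  then show ?thesis
    using overlap_in_window7[of "flip g j" 0] by (simp only: add_0)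
qed

lemma tm_flip_right:
  assumes "r \<in> {0, 1}" "8 * m + r \<le> k" "k < 8 * m + r + 7"
  shows "overlap_in (flip tm k) (8 * m + r) (8 * m + r + 7)"
proof -
  define c where "c = 8 * m + r"
  obtain j where j: "k = c + j" "j < 7"
    using assms(2,3) unfolding c_def by (metis add_less_cancel_left le_Suc_ex)
  let ?g = "\<lambda>i. tm (c + i)"
  have "overlap_in (flip ?g j) 0 7"
  proof (cases "r = 0")
    case True
    then show ?thesis
      by (intro overlap_in_flip_0110100 j(2)) (simp_all only: c_def add_0_right tm_block)
  next
    case False
    then have "r = 1" using assms(1) by simp
    have c: "c + 0 = 8 * m + 1" "c + 1 = 8 * m + 2" "c + 2 = 8 * m + 3" "c + 3 = 8 * m + 4"
      "c + 4 = 8 * m + 5" "c + 5 = 8 * m + 6" "c + 6 = 8 * m + 7"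
      by (simp_all add: c_def \<open>r = 1\<close>)
    \<comment> \<open>The window now starts with the second letter of the block, so letters are
      compared with \<open>\<not> tm m\<close> and double negations arise.\<close>
    show ?thesis
      by (intro overlap_in_flip_1101001 j(2)) (simp_all only: c tm_block not_not)
  qed
  also have "flip ?g j = (\<lambda>i. flip tm k (c + i))"
    by (auto simp: flip_def j(1))
  finally show ?thesis
    unfolding overlap_in_shift c_def .
qed

text \<open>Twenty evaluations on nine letters. The start 13 represents residue 5 modulo 8, since 5
  itself fails here: changing the first letter of its window 001100101 gives the overlap-free word
  101100101.\<close>

lemma tm_flip_left:
  assumes "a \<in> {0, 1, 3, 6, 13}" "j < 4"
  shows "overlap_in (flip tm (a + j)) a (a + 9)"
proof -
  have "j = 0 \<or> j = 1 \<or> j = 2 \<or> j = 3"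
    using assms(2) by linarith
  moreover have "tm (Suc (Suc 0))" "\<not> tm (Suc (Suc (Suc 0)))"
    using tm_Suc_double[of 1] tm_double[of 1] by (simp_all add: numeral_eq_Suc)
  ultimately show ?thesis
    using assms(1)
  proof (elim insertE emptyE disjE)
  qed (hypsubst, rule overlap_in_window9, simp add: flip_def overlap7_def)+
qed

section \<open>Witnesses of every length from 7 on\<close>

lemma delicate_tm_factor:
  assumes a: "a \<in> {0, 1, 3, 6, 13}" and "9 \<le> n" and e: "(a + n) mod 8 \<in> {0, 7}"
  shows "delicate_overlap_free (map tm [a..<a + n])"
proof -
  have "overlap_in (flip tm k) a (a + n)" if k: "a \<le> k" "k < a + n" for k
  proof -
    \<comment> \<open>The first four letters, the letters with four neighbours on each side, and the
      last four.\<close>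
    consider "k < a + 4" | "a + 4 \<le> k" "k + 4 < a + n" | "a + n \<le> k + 4"
      by linarith
    then show ?thesis
    proof cases
      case 1
      then have "overlap_in (flip tm k) a (a + 9)"
        using tm_flip_left[OF a, of "k - a"] k by simp
      then show ?thesis
        by (rule overlap_in_mono) (use assms in auto)
    next
      case 2
      then have "overlap_in (flip tm k) (k - 4) (k - 4 + 9)"
        using overlap_in_flip_center[OF tm_overlap_free, of "k - 4"] by simp
      then show ?thesis
        by (rule overlap_in_mono) (use 2 in auto)
    next
      case 3
      \<comment> \<open>The word ends with the first seven letters (\<open>r = 0\<close>) or the
        last seven letters (\<open>r = 1\<close>) of a block. These contain position
        \<open>k\<close>, and by \<open>9 \<le> n\<close> they start inside the word.\<close>
      obtain m r where mr: "r \<in> {0, 1}" "a + n = 8 * m + r + 7"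
      proof -
        obtain q where q: "a + n = 8 * q + (a + n) mod 8"
          by (metis mult_div_mod_eq)
        from e consider "(a + n) mod 8 = 7" | "(a + n) mod 8 = 0"
          by auto
        then show thesis
        proof cases
          case 1
          show thesis
            by (rule that[of 0 q]) (use q 1 in simp_all)
        next
          case 2
          then have "a + n = 8 * q"
            using q by simp
          \<comment> \<open>A right end \<open>8 * q\<close> closes the block number
            \<open>q - 1\<close>, which exists because the end is positive.\<close>
          moreover from this obtain q' where "q = Suc q'"
            using \<open>9 \<le> n\<close> by (cases q) simp_all
          ultimately show thesis
            by (intro that[of 1 q']) simp_all
        qed
      qed
      have "overlap_in (flip tm k) (8 * m + r) (8 * m + r + 7)"
        using mr(1) by (rule tm_flip_right) (use mr(2) 3 k in linarith)+
      then show ?thesis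
        by (rule overlap_in_mono) (use mr(2) \<open>9 \<le> n\<close> in linarith)+
    qed
  qed
  then show ?thesis
    unfolding delicate_factor_iff using tm_overlap_free \<open>9 \<le> n\<close> by simp
qed

lemma delicate_tm_prefix_7: "delicate_overlap_free (map tm [0..<0 + 7])"
  unfolding delicate_factor_iff using tm_overlap_free tm_flip_right[of 0 0] by simp

text \<open>Here the nine-letter windows do not fit. The two seven-letter windows of the block cover
  it: the first handles all letters but the last, the second handles that one.\<close>

lemma delicate_tm_prefix_8: "delicate_overlap_free (map tm [0..<0 + 8])"
proof -
  have "overlap_in (flip tm k) 0 8" if "k < 8" for k
  proof (cases "k < 7")
    case True
    then show ?thesis
      using overlap_in_mono[OF tm_flip_right[of 0 0 k], of 0 8] by simp
  next
    case False
    then show ?thesis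
      using that overlap_in_mono[OF tm_flip_right[of 1 0 k], of 0 8] by simp
  qed
  then show ?thesis
    unfolding delicate_factor_iff using tm_overlap_free by simp
qed

lemma ex_delicate:
  assumes "7 \<le> n"
  shows "\<exists>w. length w = n \<and> delicate_overlap_free w"
proof -
  consider "n = 7" | "n = 8" | "9 \<le> n"
    using assms by linarith
  then have "\<exists>a. delicate_overlap_free (map tm [a..<a + n])"
  proof cases
    case 1
    show ?thesis
      unfolding 1 by (rule exI, rule delicate_tm_prefix_7)
  next
    case 2
    show ?thesis
      unfolding 2 by (rule exI, rule delicate_tm_prefix_8)
  next
    case 3
    \<comment> \<open>For \<open>r\<close> = 0, ..., 7 the choices 0, 6, 6, 13, 3, 3, 1, 0
      work.\<close>
    have "\<exists>a\<in>{0, 1, 3, 6, 13}. (a + r) mod 8 \<in> {0, 7}" if "r < 8" for r :: nat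
    proof -
      have "r = 0 \<or> r = 1 \<or> r = 2 \<or> r = 3 \<or> r = 4 \<or> r = 5 \<or> r = 6 \<or> r = 7"
        using that by linarith
      then show ?thesis
        by (elim disjE) simp_all
    qed
    from this[of "n mod 8"] have "\<exists>a\<in>{0, 1, 3, 6, 13}. (a + n) mod 8 \<in> {0, 7}"
      by (simp only: mod_add_right_eq mod_less_divisor zero_less_numeral)
    then obtain a where "a \<in> {0, 1, 3, 6, 13}" "(a + n) mod 8 \<in> {0, 7}" ..
    from delicate_tm_factor[OF this(1) 3 this(2)] show ?thesis ..
  qed
  then obtain a where "delicate_overlap_free (map tm [a..<a + n])" ..
  moreover have "length (map tm [a..<a + n]) = n"
    by simp
  ultimately show ?thesis
    by metis
qed

subsection \<open>Short words\<close>

text \<open>Six letters leave room for periods 1 and 2 only. Each guard on \<open>n\<close> says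
  that the last position compared lies inside the word, so all lengths up to 6 share one
  formula.\<close>

definition overlap_upto6 :: "nat \<Rightarrow> bool \<Rightarrow> bool \<Rightarrow> bool \<Rightarrow> bool \<Rightarrow> bool \<Rightarrow> bool \<Rightarrow> bool" where
  "overlap_upto6 n b0 b1 b2 b3 b4 b5 \<longleftrightarrow>
    2 < n \<and> b0 = b1 \<and> b1 = b2 \<or> 3 < n \<and> b1 = b2 \<and> b2 = b3 \<or>
    4 < n \<and> (b2 = b3 \<and> b3 = b4 \<or> b0 = b2 \<and> b1 = b3 \<and> b2 = b4) \<or>
    5 < n \<and> (b3 = b4 \<and> b4 = b5 \<or> b1 = b3 \<and> b2 = b4 \<and> b3 = b5)"

text \<open>The failure of delicacy as a propositional check: an overlap is already present, or some
  letter inside the word can be changed without creating one.\<close>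

lemma overlap_upto6_flip:
  assumes "n = 1 \<or> n = 2 \<or> n = 3 \<or> n = 4 \<or> n = 5 \<or> n = 6"
  shows "overlap_upto6 n b0 b1 b2 b3 b4 b5 \<or>
    \<not> overlap_upto6 n (\<not> b0) b1 b2 b3 b4 b5 \<or>
    1 < n \<and> \<not> overlap_upto6 n b0 (\<not> b1) b2 b3 b4 b5 \<or>
    2 < n \<and> \<not> overlap_upto6 n b0 b1 (\<not> b2) b3 b4 b5 \<or>
    3 < n \<and> \<not> overlap_upto6 n b0 b1 b2 (\<not> b3) b4 b5 \<or>
    4 < n \<and> \<not> overlap_upto6 n b0 b1 b2 b3 (\<not> b4) b5 \<or>
    5 < n \<and> \<not> overlap_upto6 n b0 b1 b2 b3 b4 (\<not> b5)"
  by (insert assms, elim disjE; hypsubst)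
    (cases b0; cases b1; cases b2; cases b3; cases b4; cases b5; simp add: overlap_upto6_def)+

lemma overlap_in_short:
  assumes "n \<le> 6"
  shows "overlap_in f 0 n \<longleftrightarrow> overlap_upto6 n (f 0) (f 1) (f 2) (f 3) (f 4) (f 5)"
proof
  assume "overlap_in f 0 n"
  then obtain i p where *: "0 < p" "i + 2 * p < n" and per: "\<And>j. j \<le> p \<Longrightarrow> f (i + j) = f (i + j + p)"
    unfolding overlap_in_def by blast
  \<comment> \<open>All pairs with \<open>i + 2 * p < 6\<close>.\<close>
  have "p = 1 \<and> i = 0 \<or> p = 1 \<and> i = 1 \<or> p = 1 \<and> i = 2 \<or> p = 1 \<and> i = 3 \<or>
      p = 2 \<and> i = 0 \<or> p = 2 \<and> i = 1"
    using * assms by presburger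
  then show "overlap_upto6 n (f 0) (f 1) (f 2) (f 3) (f 4) (f 5)"
    unfolding overlap_upto6_def
  proof (elim disjE conjE)
  qed (use per[of 0] per[of 1] per[of 2] * in \<open>simp_all add: eval_nat_numeral\<close>)
next
  assume "overlap_upto6 n (f 0) (f 1) (f 2) (f 3) (f 4) (f 5)"
  then show "overlap_in f 0 n"
    unfolding overlap_upto6_def
  proof (elim disjE conjE)
  qed (use overlap_in_of_period(1)[of f 0 0 n]
      overlap_in_of_period(1)[of f 1 0 n]
      overlap_in_of_period(1)[of f 2 0 n]
      overlap_in_of_period(1)[of f 3 0 n]
      overlap_in_of_period(2)[of f 0 0 n]
      overlap_in_of_period(2)[of f 1 0 n] in \<open>simp_all add: eval_nat_numeral\<close>)
qed

lemma short_not_delicate: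
  assumes "length w \<le> 6"
  shows "\<not> delicate_overlap_free w"
proof
  assume "delicate_overlap_free w"
  then have w: "0 < length w" "\<not> overlap_in ((!) w) 0 (length w)"
    and fl: "\<And>k. k < length w \<Longrightarrow> overlap_in (flip ((!) w) k) 0 (length w)"
    unfolding delicate_iff_nth by auto
  \<comment> \<open>Values of \<open>f\<close> beyond the end of \<open>w\<close> are unspecified
    but harmless, because the guards in \<open>overlap_upto6\<close> exclude them.\<close>
  define f where "f = (!) w"
  have "length w = 1 \<or> length w = 2 \<or> length w = 3 \<or> length w = 4 \<or> length w = 5 \<or> length w = 6"
    using w(1) assms by linarith
  note overlap_upto6_flip[OF this, of "f 0" "f 1" "f 2" "f 3" "f 4" "f 5"]
  moreover have "overlap_upto6 (length w) (flip f k 0) (flip f k 1) (flip f k 2) (flip f k 3) (flip f k 4) (flip f k 5)"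
    if "k < length w" for k
    using fl[OF that] unfolding overlap_in_short[OF assms] f_def .
  note this[of 0] this[of 1] this[of 2] this[of 3] this[of 4] this[of 5]
  moreover have "\<not> overlap_upto6 (length w) (f 0) (f 1) (f 2) (f 3) (f 4) (f 5)"
    using w(2) unfolding overlap_in_short[OF assms] f_def .
  ultimately show False
    using w(1) by (auto simp: flip_def)
qed

theorem theorem4:
  fixes n :: nat
  shows "(\<exists>w :: binary_word. length w = n \<and> delicate_overlap_free w) \<longleftrightarrow> n \<ge> 7"
proof
  assume "\<exists>w :: binary_word. length w = n \<and> delicate_overlap_free w"
  then have "\<not> n \<le> 6"
    using short_not_delicate by blast
  then show "7 \<le> n"
    by simp
qed (rule ex_delicate)

end
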